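(* If $I$ is a lifting ideal of a commutative ring $R$ and $J$ is a regular ideal of $R$, then $I+J$ is a lifting ideal of $R$.
   Context: All rings are commutative with $1$. An ideal $I$ of a ring $R$ is called a lifting ideal of $R$ if every idempotent of $R/I$ is the image of an idempotent of $R$; equivalently, whenever $f\in R$ satisfies $f-f^{2}\in I$, there exists an idempotent $e\in R$ with $f-e\in I$. A regular ideal of $R$ is an ideal generated by a set of idempotents of $R$. *)

theory Defs
  imports "HOL-Algebra.Algebra"
begin

definition idempotents :: "('a, 'b) ring_scheme \<Rightarrow> 'a set" where
  "idempotents R = {e \<in> carrier R. e \<otimes>\<^bsub>R\<^esub> e = e}"

definition lifting_ideal :: "('a, 'b) ring_scheme \<Rightarrow> 'a set \<Rightarrow> bool" where
  "lifting_ideal R I \<longleftrightarrow>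
     ideal I R \<and> (\<forall>x \<in> idempotents (R Quot I). \<exists>e \<in> idempotents R. x = I +>\<^bsub>R\<^esub> e)"

(* The generating set E may be empty or infinite. *)
definition regular_ideal :: "('a, 'b) ring_scheme \<Rightarrow> 'a set \<Rightarrow> bool" where
  "regular_ideal R J \<longleftrightarrow> (\<exists>E. E \<subseteq> idempotents R \<and> J = Idl\<^bsub>R\<^esub> E)"

end

theory Submission
  imports Defs
begin

text \<open>Given \<open>f - f\<^sup>2 = i + j\<close> with \<open>i \<in> I\<close> and \<open>j \<in> J\<close>, choose an idempotent \<open>u \<in> J\<close> with \<open>j u = j\<close>.
  Multiplying by \<open>1 - u\<close> kills \<open>j\<close>, so \<open>g = f (1 - u)\<close> is idempotent modulo \<open>I\<close>. An idempotent \<open>e\<close>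
  lifting \<open>g\<close> modulo \<open>I\<close> then lifts \<open>f\<close> modulo \<open>I + J\<close>, because \<open>f - e = (g - e) + f u\<close>.\<close>

lemma (in cring) idempotents_quot_iff:
  assumes "ideal I R" "f \<in> carrier R"
  shows "I +> f \<in> idempotents (R Quot I) \<longleftrightarrow> f \<ominus> f \<otimes> f \<in> I"
proof -
  have "I +> f \<in> carrier (R Quot I)"
    using assms by (auto simp: FactRing_def A_RCOSETS_def')
  moreover have "(I +> f) \<otimes>\<^bsub>R Quot I\<^esub> (I +> f) = I +> (f \<otimes> f)"
    using ideal.rcoset_mult_add[OF assms(1)] assms(2) by (simp add: FactRing_def)
  ultimately have "I +> f \<in> idempotents (R Quot I) \<longleftrightarrow> I +> f = I +> (f \<otimes> f)"
    by (auto simp: idempotents_def)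
  then show ?thesis
    using quotient_eq_iff_same_a_r_cos[OF assms(1), of f "f \<otimes> f"] assms(2) by simp
qed

text \<open>Every element of the quotient is the coset of some \<open>f\<close>, and two cosets
  agree exactly when the difference of their representatives lies in \<open>I\<close>. Quantifying
  over representatives in this way lets the rest of the argument run inside \<open>R\<close>,
  without cosets.\<close>

lemma (in cring) lifting_ideal_iff:
  "lifting_ideal R I \<longleftrightarrow> ideal I R \<and>
     (\<forall>f \<in> carrier R. f \<ominus> f \<otimes> f \<in> I \<longrightarrow> (\<exists>e \<in> idempotents R. f \<ominus> e \<in> I))"
proof (cases "ideal I R")
  case True
  have "idempotents (R Quot I) \<subseteq> (\<lambda>f. I +> f) ` carrier R"
    by (auto simp: idempotents_def FactRing_def A_RCOSETS_def')
  then have cosets: "idempotents (R Quot I) = (\<lambda>f. I +> f) ` {f \<in> carrier R. f \<ominus> f \<otimes> f \<in> I}"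
    by (auto simp: idempotents_quot_iff[OF True])
  have "I +> f = I +> e \<longleftrightarrow> f \<ominus> e \<in> I" if "f \<in> carrier R" "e \<in> idempotents R" for f e
    using quotient_eq_iff_same_a_r_cos[OF True that(1), of e] that(2) by (simp add: idempotents_def)
  then show ?thesis
    unfolding lifting_ideal_def cosets using True by (simp add: imp_conjL Ball_def[of "carrier R"] cong: bex_cong)
qed (simp add: lifting_ideal_def)

text \<open>The elements fixed by some idempotent of \<open>Idl E\<close> form an ideal that
  contains \<open>E\<close>, so minimality of \<open>Idl E\<close> applies. This avoids writing
  \<open>j\<close> as a finite combination of generators.\<close>

lemma (in cring) genideal_idempotents_local_unit:
  assumes E: "E \<subseteq> idempotents R" and j: "j \<in> Idl E"
  shows "\<exists>u \<in> idempotents R \<inter> Idl E. j \<otimes> u = j"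
proof -
  have E_carrier: "E \<subseteq> carrier R"
    using E by (auto simp: idempotents_def)
  interpret J: ideal "Idl E" R
    by (rule genideal_ideal[OF E_carrier])
  \<comment> \<open>The unit \<open>u\<close> may be any idempotent of \<open>Idl E\<close>: closure
    under sums needs joins of units, and these need not lie in \<open>E\<close>.\<close>
  define S where "S = {x \<in> carrier R. \<exists>u \<in> idempotents R \<inter> Idl E. x \<otimes> u = x}"
  have add: "x \<oplus> y \<in> S" if x: "x \<in> S" and y: "y \<in> S" for x y
  proof -
    obtain u where u0: "u \<in> idempotents R" "u \<in> Idl E" "x \<otimes> u = x"
      using x by (auto simp: S_def)
    obtain v where v0: "v \<in> idempotents R" "v \<in> Idl E" "y \<otimes> v = y"
      using y by (auto simp: S_def)
    note u = u0(2,3) u0(1)[unfolded idempotents_def, simplified]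
    note v = v0(2,3) v0(1)[unfolded idempotents_def, simplified]
    have xy: "x \<in> carrier R" "y \<in> carrier R"
      using x y by (auto simp: S_def)
    have uv: "u \<in> carrier R" "v \<in> carrier R"
      using u v by auto
    \<comment> \<open>This is the join of \<open>u\<close> and \<open>v\<close>: 1 - w = (1 - u)(1 -
      v), so whatever is killed by 1 - u or by 1 - v is killed by 1 - w.\<close>
    define w where "w = u \<oplus> v \<ominus> u \<otimes> v"
    have w: "w \<in> carrier R"
      using u v by (simp add: w_def)
    have expand: "z \<otimes> w = z \<otimes> u \<oplus> z \<otimes> v \<ominus> z \<otimes> u \<otimes> v" if "z \<in> carrier R" for z
      using uv that unfolding w_def by algebra
    have absorb: "z \<otimes> w = z" if z: "z \<in> carrier R" "z \<otimes> u = z \<or> z \<otimes> v = z" for z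
    proof -
      \<comment> \<open>If z u = z, then z u v = z v cancels the middle term of
        \<open>expand\<close>. If z v = z, commuting the factors gives z u v = z u, which cancels
        the first term. Either way z remains.\<close>
      have "a \<oplus> b \<ominus> a = b" "b \<oplus> a \<ominus> a = b" if "a \<in> carrier R" "b \<in> carrier R" for a b
        using that by algebra+
      moreover have "z \<otimes> u \<otimes> v = z \<otimes> v \<otimes> u"
        using uv z(1) by (simp add: m_ac)
      ultimately show ?thesis
        using z(2) expand[OF z(1)] uv z(1) by auto
    qed
    \<comment> \<open>With \<open>z\<close> taken to be \<open>w\<close> itself,
      \<open>absorb\<close> turns w u into u and w v into v, which leaves the definition of
      \<open>w\<close>.\<close>
    have "w \<otimes> w = w \<otimes> u \<oplus> w \<otimes> v \<ominus> w \<otimes> u \<otimes> v"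
      by (rule expand[OF w])
    also have "\<dots> = u \<oplus> v \<ominus> u \<otimes> v"
      using absorb[of u] absorb[of v] u v w by (simp add: m_comm[OF w])
    finally have "w \<otimes> w = w"
      by (simp add: w_def)
    moreover have "w \<in> Idl E"
      unfolding w_def a_minus_def using u v J.I_l_closed by simp
    moreover have "(x \<oplus> y) \<otimes> w = x \<oplus> y"
      using absorb[of x] absorb[of y] u v xy w by (simp add: l_distr)
    ultimately show ?thesis
      using w xy by (auto simp: S_def idempotents_def)
  qed
  have SI: "x \<in> S" if "x \<in> carrier R" "u \<in> idempotents R \<inter> Idl E" "x \<otimes> u = x" for x u
    using that by (auto simp: S_def)
  have mult: "r \<otimes> x \<in> S" if xS: "x \<in> S" and r: "r \<in> carrier R" for r x
  proof -
    obtain u where u: "u \<in> idempotents R \<inter> Idl E" "x \<otimes> u = x" and x: "x \<in> carrier R"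
      using xS by (auto simp: S_def)
    then have "u \<in> carrier R"
      by (simp add: idempotents_def)
    then show ?thesis
      using SI[OF _ u(1)] u(2) x r by (simp add: m_assoc)
  qed
  have "\<zero> \<in> S"
    by (auto simp: S_def idempotents_def intro!: bexI[of _ \<zero>])
  \<comment> \<open>Negation is multiplication by -1.\<close>
  moreover have "\<ominus> x \<in> S" if "x \<in> S" for x
    using mult[OF that, of "\<ominus> \<one>"] that by (simp add: S_def l_minus)
  moreover have "S \<subseteq> carrier R"
    by (auto simp: S_def)
  ultimately have "subgroup S (add_monoid R)"
    using add by (intro add.subgroupI) (auto simp: a_inv_def)
  moreover have "x \<otimes> r \<in> S" if "x \<in> S" "r \<in> carrier R" for r x
    using mult[OF that] that \<open>S \<subseteq> carrier R\<close> by (metis m_comm subsetD)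
  ultimately have "ideal S R"
    using mult by (intro idealI ring_axioms) auto
  \<comment> \<open>Each generator is idempotent, hence its own local unit.\<close>
  moreover have "E \<subseteq> S"
    using E genideal_self[OF E_carrier] by (auto simp: S_def idempotents_def)
  ultimately have "Idl E \<subseteq> S"
    by (rule genideal_minimal)
  with j show ?thesis
    by (auto simp: S_def)
qed

theorem corollary3p19:
  fixes R :: "('a, 'b) ring_scheme"
  assumes "cring R"
    and "lifting_ideal R I"
    and "regular_ideal R J"
  shows "lifting_ideal R (I <+>\<^bsub>R\<^esub> J)"
proof -
  interpret cring R by fact
  obtain E where E: "E \<subseteq> idempotents R" and J: "J = Idl\<^bsub>R\<^esub> E"
    using assms(3) by (auto simp: regular_ideal_def)
  interpret I: ideal I R
    using assms(2) by (simp add: lifting_ideal_def)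
  interpret J: ideal J R
    unfolding J using E by (intro genideal_ideal) (auto simp: idempotents_def)
  have "\<exists>e \<in> idempotents R. f \<ominus>\<^bsub>R\<^esub> e \<in> I <+>\<^bsub>R\<^esub> J"
    if f: "f \<in> carrier R" and f2: "f \<ominus>\<^bsub>R\<^esub> f \<otimes>\<^bsub>R\<^esub> f \<in> I <+>\<^bsub>R\<^esub> J" for f
  proof -
    obtain i j where ij: "i \<in> I" "j \<in> J" "f \<ominus>\<^bsub>R\<^esub> f \<otimes>\<^bsub>R\<^esub> f = i \<oplus>\<^bsub>R\<^esub> j"
      using f2 by (auto simp: set_add_def')
    obtain u where u_idem: "u \<in> idempotents R" and uJ: "u \<in> J" "j \<otimes>\<^bsub>R\<^esub> u = j"
      using genideal_idempotents_local_unit[OF E, folded J] ij(2) by auto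
    then have u: "u \<in> carrier R" "u \<otimes>\<^bsub>R\<^esub> u = u" "u \<in> J" "j \<otimes>\<^bsub>R\<^esub> u = j"
      by (simp_all add: idempotents_def)
    define g where "g = f \<ominus>\<^bsub>R\<^esub> f \<otimes>\<^bsub>R\<^esub> u"
    have g: "g \<in> carrier R"
      using f u by (simp add: g_def)
    have car: "i \<in> carrier R" "j \<in> carrier R"
      using ij I.a_subset J.a_subset by auto
    \<comment> \<open>The product u u stays unreduced here, so that this is a pure ring identity.
      Replacing it by u afterwards yields g - g g = (f - f f)(1 - u), because 1 - u is idempotent
      too.\<close>
    have "g \<otimes>\<^bsub>R\<^esub> g = f \<otimes>\<^bsub>R\<^esub> f \<ominus>\<^bsub>R\<^esub> f \<otimes>\<^bsub>R\<^esub> f \<otimes>\<^bsub>R\<^esub> u \<ominus>\<^bsub>R\<^esub> f \<otimes>\<^bsub>R\<^esub> f \<otimes>\<^bsub>R\<^esub> u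
        \<oplus>\<^bsub>R\<^esub> f \<otimes>\<^bsub>R\<^esub> f \<otimes>\<^bsub>R\<^esub> (u \<otimes>\<^bsub>R\<^esub> u)"
      using f u(1) unfolding g_def by algebra
    then have "g \<ominus>\<^bsub>R\<^esub> g \<otimes>\<^bsub>R\<^esub> g
        = (f \<ominus>\<^bsub>R\<^esub> f \<otimes>\<^bsub>R\<^esub> f) \<ominus>\<^bsub>R\<^esub> (f \<ominus>\<^bsub>R\<^esub> f \<otimes>\<^bsub>R\<^esub> f) \<otimes>\<^bsub>R\<^esub> u"
      unfolding u(2) using f u(1) unfolding g_def by algebra
    also have "\<dots> = i \<oplus>\<^bsub>R\<^esub> j \<ominus>\<^bsub>R\<^esub> (i \<otimes>\<^bsub>R\<^esub> u \<oplus>\<^bsub>R\<^esub> j \<otimes>\<^bsub>R\<^esub> u)"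
      using car u(1) by (simp add: ij(3) l_distr)
    \<comment> \<open>The two copies of \<open>j\<close> cancel, so only a multiple of
      \<open>i\<close> is left.\<close>
    also have "\<dots> = i \<ominus>\<^bsub>R\<^esub> i \<otimes>\<^bsub>R\<^esub> u"
      unfolding u(4) using car u(1) by algebra
    finally have "g \<ominus>\<^bsub>R\<^esub> g \<otimes>\<^bsub>R\<^esub> g \<in> I"
      using ij(1) u(1) by (simp add: a_minus_def I.I_r_closed)
    then obtain e where e: "e \<in> idempotents R" "g \<ominus>\<^bsub>R\<^esub> e \<in> I"
      using assms(2) g by (auto simp: lifting_ideal_iff)
    then have "f \<ominus>\<^bsub>R\<^esub> e = (g \<ominus>\<^bsub>R\<^esub> e) \<oplus>\<^bsub>R\<^esub> f \<otimes>\<^bsub>R\<^esub> u"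
      using f u(1) unfolding g_def idempotents_def mem_Collect_eq by algebra
    moreover have "f \<otimes>\<^bsub>R\<^esub> u \<in> J"
      using f u(3) by (rule J.I_l_closed[rotated])
    ultimately show ?thesis
      using e by (auto simp: set_add_def')
  qed
  then show ?thesis
    using add_ideals[OF I.ideal_axioms J.ideal_axioms] by (simp add: lifting_ideal_iff)
qed

end
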